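(* Let $f \in \mathcal{S}^{*}_{\mathrm{car}}$. Then $$|\sigma_3(f)(0)| \le 4 \quad\text{and}\quad |\sigma_4(f)(0)| \le \frac{448}{27}.$$ These bounds are sharp, i.e. for each of the two inequalities there is a function in $\mathcal{S}^*_{\mathrm{car}}$ for which equality holds.
   Context: $\mathbb{D}=\{z\in\mathbb{C}:|z|<1\}$. $\mathcal{A}$ is the class of analytic functions $f$ on $\mathbb{D}$ with $f(0)=0$, $f'(0)=1$. For analytic $f,g$ on $\mathbb{D}$, $f\prec g$ (subordination) means there is an analytic function $\omega$ on $\mathbb{D}$ with $\omega(0)=0$, $|\omega(z)|<1$ and $f(z)=g(\omega(z))$ for all $z\in\mathbb{D}$. $\mathcal{S}^*_{\mathrm{car}}$ is the class of $f\in\mathcal{A}$ such that $\frac{zf'(z)}{f(z)}\prec 1+\frac43z+\frac23z^2$. Higher-order (Schippers) Schwarzian derivatives of a locally univalent function $f$ on $\mathbb{D}$: $\sigma_3(f)=S_f=\left(\frac{f''}{f'}\right)'-\frac12\left(\frac{f''}{f'}\right)^2$ and, for $n\ge 3$, $\sigma_{n+1}(f)=\sigma_n'(f)-(n-1)\sigma_n(f)\frac{f''}{f'}$, where $\sigma_n'(f)$ is the derivative of the function $\sigma_n(f)$ with respect to $z$. For $f(z)=z+\sum_{n\ge2}a_nz^n$ the values at the origin are $\sigma_3(f)(0)=6(a_3-a_2^2)$ and $\sigma_4(f)(0)=24(a_4-3a_2a_3+2a_2^3)$. *)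

theory Defs
  imports "HOL-Complex_Analysis.Complex_Analysis"
begin

abbreviation unit_disk :: "complex set" (\<open>\<bbbD>\<close>) where
  "\<bbbD> \<equiv> ball 0 1"

text \<open>Functions on the disk are total functions of type \<^typ>\<open>complex \<Rightarrow> complex\<close>;
  their values outside the disk play no role.\<close>

definition class_A :: "(complex \<Rightarrow> complex) set" (\<open>\<A>\<close>) where
  "\<A> = {f. f holomorphic_on \<bbbD> \<and> f 0 = 0 \<and> deriv f 0 = 1}"

definition subordinate :: "(complex \<Rightarrow> complex) \<Rightarrow> (complex \<Rightarrow> complex) \<Rightarrow> bool"
    (infix \<open>\<prec>\<close> 50) where
  "f \<prec> g \<longleftrightarrow> f holomorphic_on \<bbbD> \<and> g holomorphic_on \<bbbD> \<and>
     (\<exists>w. w holomorphic_on \<bbbD> \<and> w 0 = 0 \<and>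
          (\<forall>z\<in>\<bbbD>. norm (w z) < 1 \<and> f z = g (w z)))"

text \<open>For \<open>f \<in> \<A>\<close> the quotient \<open>z f'(z) / f(z)\<close> has a removable singularity at the origin,
  where its value is 1.\<close>

definition starlike_quotient :: "(complex \<Rightarrow> complex) \<Rightarrow> complex \<Rightarrow> complex" where
  "starlike_quotient f z = (if z = 0 then 1 else z * deriv f z / f z)"

text \<open>The condition \<open>f z \<noteq> 0\<close> is what makes the quotient defined on the whole disk; it has to be
  explicit because division by zero yields 0 in HOL.\<close>

definition S_car :: "(complex \<Rightarrow> complex) set" where
  "S_car = {f \<in> \<A>. (\<forall>z \<in> \<bbbD> - {0}. f z \<noteq> 0) \<and>
                    starlike_quotient f \<prec> (\<lambda>z. 1 + 4/3 * z + 2/3 * z^2)}"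

definition pre_schwarzian :: "(complex \<Rightarrow> complex) \<Rightarrow> complex \<Rightarrow> complex" where
  "pre_schwarzian f z = deriv (deriv f) z / deriv f z"

definition schwarzian :: "(complex \<Rightarrow> complex) \<Rightarrow> complex \<Rightarrow> complex" where
  "schwarzian f z = deriv (pre_schwarzian f) z - 1/2 * (pre_schwarzian f z)^2"

text \<open>The recursion starts at index 3; smaller indices are junk values.\<close>

primrec schippers :: "nat \<Rightarrow> (complex \<Rightarrow> complex) \<Rightarrow> complex \<Rightarrow> complex" (\<open>\<sigma>\<close>) where
  "\<sigma> 0 f = schwarzian f"
| "\<sigma> (Suc n) f =
     (if n < 3 then schwarzian f
      else (\<lambda>z. deriv (\<sigma> n f) z - (of_nat n - 1) * \<sigma> n f z * pre_schwarzian f z))"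

end

theory Submission imports Defs begin

text \<open>
  Write \<open>z f'(z) / f(z) = 1 + 4/3 w(z) + 2/3 w(z)\<^sup>2\<close> with a Schwarz function
  \<open>w(z) = c\<^sub>1 z + c\<^sub>2 z\<^sup>2 + c\<^sub>3 z\<^sup>3 + \<dots>\<close>. Comparing coefficients gives
  \<open>\<sigma>\<^sub>3(f)(0) = 4 c\<^sub>2 - 10/3 c\<^sub>1\<^sup>2\<close> and
  \<open>\<sigma>\<^sub>4(f)(0) = 32/3 (c\<^sub>3 - 3 c\<^sub>1 c\<^sub>2 + 14/9 c\<^sub>1\<^sup>3)\<close>.
  The Schur algorithm writes \<open>c\<^sub>1 = a\<close>, \<open>c\<^sub>2 = (1 - |a|\<^sup>2) b\<close>,
  \<open>c\<^sub>3 = (1 - |a|\<^sup>2) ((1 - |b|\<^sup>2) d - cnj a b\<^sup>2)\<close> with \<open>a, b, d\<close> in the closed unit disk.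
  The first bound is then immediate. In the second one the triangle inequality removes \<open>d\<close>, and
  after a rotation making \<open>a\<close> real, squaring leaves a polynomial inequality in \<open>|a|\<^sup>2\<close>,
  \<open>|b|\<^sup>2\<close> and \<open>Re b\<close>. Equality holds for \<open>w(z) = z\<^sup>2\<close> and \<open>w(z) = z\<close> respectively.
\<close>

section \<open>Schwarz functions and the Schur algorithm\<close>

lemma Schwarz_factor:
  assumes holw: "w holomorphic_on \<bbbD>" and w0: "w 0 = 0"
    and less: "\<And>z. norm z < 1 \<Longrightarrow> norm (w z) < 1"
  obtains h where "h holomorphic_on \<bbbD>" "\<And>z. norm z < 1 \<Longrightarrow> norm (h z) \<le> 1"
    "\<And>z. norm z < 1 \<Longrightarrow> w z = z * h z"
proof -
  obtain h where h: "h holomorphic_on \<bbbD>" "\<And>z. norm z < 1 \<Longrightarrow> w z = z * h z" "deriv w 0 = h 0"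
    using Schwarz3[OF holw w0] by metis
  \<comment> \<open>The bound cannot be strict: \<open>h\<close> is a unimodular constant when
    \<open>w\<close> is a rotation. At the origin it is the derivative part of the Schwarz
    lemma.\<close>
  have "norm (h z) \<le> 1" if z: "norm z < 1" for z
  proof (cases "z = 0")
    case True
    then show ?thesis
      using Schwarz_Lemma(2)[OF holw w0 less, of 0] h(3) by simp
  next
    case False
    have "norm z * norm (h z) \<le> norm z * 1"
      using Schwarz_Lemma(1)[OF holw w0 less z] h(2)[OF z] by (simp add: norm_mult)
    then show ?thesis
      using False by simp
  qed
  with h show thesis
    using that by blast
qed

text \<open>If \<open>norm g\<close> attains 1 inside the disk, \<open>g\<close> is constant and
  \<open>h = 0\<close> works. Otherwise the Moebius map sending \<open>g 0\<close> to 0 turns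
  \<open>g\<close> into a Schwarz function, from which a factor \<open>z\<close> splits off.
  Clearing the denominator covers both cases by one identity and allows coefficients to be compared
  without division.\<close>

lemma Schur_step:
  assumes holg: "g holomorphic_on \<bbbD>" and le: "\<And>z. norm z < 1 \<Longrightarrow> norm (g z) \<le> 1"
  obtains h where "h holomorphic_on \<bbbD>" "\<And>z. norm z < 1 \<Longrightarrow> norm (h z) \<le> 1"
    "\<And>z. norm z < 1 \<Longrightarrow> g z * (1 + cnj (g 0) * (z * h z)) = g 0 + z * h z"
proof (cases "\<exists>\<xi>. norm \<xi> < 1 \<and> norm (g \<xi>) = 1")
  case True
  then obtain \<xi> where \<xi>: "norm \<xi> < 1" "norm (g \<xi>) = 1"
    by blast
  have "g constant_on \<bbbD>"
    by (rule maximum_modulus_principle[OF holg open_ball connected_ball open_ball, of 0 1 \<xi>])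
      (use \<xi> le in auto)
  then have const: "g z = g 0" if "norm z < 1" for z
    using that unfolding constant_on_def by force
  show ?thesis
  proof (rule that[of "\<lambda>_. 0"])
    show "g z * (1 + cnj (g 0) * (z * 0)) = g 0 + z * 0" if "norm z < 1" for z
      using const[OF that] by simp
  qed simp_all
next
  case False
  have less: "norm (g z) < 1" if "norm z < 1" for z
    using le[OF that] False that by force
  define M where "M = Moebius_function 0 (g 0)"
  have "M holomorphic_on \<bbbD>"
    unfolding M_def by (rule Moebius_function_holomorphic) (simp add: less)
  then have "(M \<circ> g) holomorphic_on \<bbbD>"
    by (intro holomorphic_on_compose_gen[OF holg]) (auto simp: less)
  moreover have "(M \<circ> g) 0 = 0"
    by (simp add: M_def Moebius_function_eq_zero)
  moreover have "norm ((M \<circ> g) z) < 1" if "norm z < 1" for z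
    using that by (auto simp: M_def less intro!: Moebius_function_norm_lt_1)
  ultimately obtain h where h: "h holomorphic_on \<bbbD>" "\<And>z. norm z < 1 \<Longrightarrow> norm (h z) \<le> 1"
    "\<And>z. norm z < 1 \<Longrightarrow> (M \<circ> g) z = z * h z"
    using Schwarz_factor by blast
  have "g z * (1 + cnj (g 0) * (z * h z)) = g 0 + z * h z" if z: "norm z < 1" for z
  proof -
    have "norm (cnj (g 0) * g z) < 1"
      using norm_mult_less[of "cnj (g 0)" 1 "g z" 1] less z by simp
    then have nz: "1 - cnj (g 0) * g z \<noteq> 0"
      by force
    have "(g z - g 0) / (1 - cnj (g 0) * g z) = z * h z"
      using h(3)[OF z] by (simp add: M_def Moebius_function_simple)
    then have "g z - g 0 = z * h z * (1 - cnj (g 0) * g z)"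
      using nz by (simp add: divide_eq_eq)
    then show ?thesis
      by (simp add: algebra_simps)
  qed
  with h show ?thesis
    using that by blast
qed

lemma has_fps_expansion_unit_disk:
  "f holomorphic_on \<bbbD> \<Longrightarrow> f has_fps_expansion fps_expansion f 0"
  by (rule has_fps_expansion_fps_expansion[of \<bbbD>]) auto

lemma fps_eq_if_eq_on_unit_disk:
  fixes f g :: "complex \<Rightarrow> complex"
  assumes "f has_fps_expansion F" "g has_fps_expansion G" "\<And>z. norm z < 1 \<Longrightarrow> f z = g z"
  shows "F = G"
proof -
  have "eventually (\<lambda>z. f z = g z) (nhds 0)"
    using eventually_nhds_in_open[of \<bbbD> 0] by (rule eventually_mono) (use assms(3) in auto)
  then have "g has_fps_expansion F"
    using assms(1) has_fps_expansion_cong by blast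
  then show ?thesis
    using assms(2) fps_expansion_unique_complex by blast
qed

lemma Schur_step_fps:
  assumes holg: "g holomorphic_on \<bbbD>" and le: "\<And>z. norm z < 1 \<Longrightarrow> norm (g z) \<le> 1"
  obtains h where "h holomorphic_on \<bbbD>" "\<And>z. norm z < 1 \<Longrightarrow> norm (h z) \<le> 1"
    "fps_expansion g 0 * (1 + fps_const (cnj (g 0)) * (fps_X * fps_expansion h 0)) =
       fps_const (g 0) + fps_X * fps_expansion h 0"
proof -
  obtain h where h: "h holomorphic_on \<bbbD>" "\<And>z. norm z < 1 \<Longrightarrow> norm (h z) \<le> 1"
    "\<And>z. norm z < 1 \<Longrightarrow> g z * (1 + cnj (g 0) * (z * h z)) = g 0 + z * h z"
    using Schur_step[OF assms] by blast
  note exp = has_fps_expansion_unit_disk[OF holg] has_fps_expansion_unit_disk[OF h(1)]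
  have "(\<lambda>z. g z * (1 + cnj (g 0) * (z * h z))) has_fps_expansion
      fps_expansion g 0 * (1 + fps_const (cnj (g 0)) * (fps_X * fps_expansion h 0))"
    by (intro fps_expansion_intros exp)
  moreover have "(\<lambda>z. g 0 + z * h z) has_fps_expansion
      fps_const (g 0) + fps_X * fps_expansion h 0"
    by (intro fps_expansion_intros exp)
  ultimately have "fps_expansion g 0 * (1 + fps_const (cnj (g 0)) * (fps_X * fps_expansion h 0)) =
       fps_const (g 0) + fps_X * fps_expansion h 0"
    using h(3) by (rule fps_eq_if_eq_on_unit_disk)
  with h show thesis
    using that by blast
qed

lemma fps_expansion_nth_0: "fps_nth (fps_expansion f 0) 0 = f 0"
  by (simp add: fps_expansion_def)

lemma Schwarz_coeffs:
  assumes holw: "w holomorphic_on \<bbbD>" and w0: "w 0 = 0"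
    and less: "\<And>z. norm z < 1 \<Longrightarrow> norm (w z) < 1"
    and W: "w has_fps_expansion W"
  obtains a b d where "norm a \<le> 1" "norm b \<le> 1" "norm d \<le> 1"
    "fps_nth W 1 = a"
    "fps_nth W 2 = (1 - of_real (norm a ^ 2)) * b"
    "fps_nth W 3 = (1 - of_real (norm a ^ 2)) * ((1 - of_real (norm b ^ 2)) * d - cnj a * b ^ 2)"
proof -
  obtain g where g: "g holomorphic_on \<bbbD>" "\<And>z. norm z < 1 \<Longrightarrow> norm (g z) \<le> 1"
    "\<And>z. norm z < 1 \<Longrightarrow> w z = z * g z"
    using Schwarz_factor[OF holw w0 less] by blast
  obtain h where h: "h holomorphic_on \<bbbD>" "\<And>z. norm z < 1 \<Longrightarrow> norm (h z) \<le> 1"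
    and gh: "fps_expansion g 0 * (1 + fps_const (cnj (g 0)) * (fps_X * fps_expansion h 0)) =
       fps_const (g 0) + fps_X * fps_expansion h 0"
    using Schur_step_fps[OF g(1,2)] by blast
  obtain k where k: "k holomorphic_on \<bbbD>" "\<And>z. norm z < 1 \<Longrightarrow> norm (k z) \<le> 1"
    and hk: "fps_expansion h 0 * (1 + fps_const (cnj (h 0)) * (fps_X * fps_expansion k 0)) =
       fps_const (h 0) + fps_X * fps_expansion k 0"
    using Schur_step_fps[OF h(1,2)] by blast
  \<comment> \<open>The parameters will be \<open>a = g 0\<close>, \<open>b = h 0\<close>,
    \<open>d = k 0\<close>. Since \<open>w z = z * g z\<close>, the coefficients 1, 2, 3 of
    \<open>W\<close> are the coefficients 0, 1, 2 of \<open>G\<close>.\<close>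
  define G H where "G = fps_expansion g 0" and "H = fps_expansion h 0"
  have WG: "W = fps_X * G"
    unfolding G_def
    by (rule fps_eq_if_eq_on_unit_disk[OF W _ g(3)])
      (intro fps_expansion_intros has_fps_expansion_unit_disk[OF g(1)])+
  note 0 = fps_expansion_nth_0[of g, folded G_def] fps_expansion_nth_0[of h, folded H_def]
  have H1: "fps_nth H 1 = (1 - h 0 * cnj (h 0)) * k 0"
    using arg_cong[OF hk, of "\<lambda>F. fps_nth F 1"]
    by (simp add: fps_mult_nth fps_expansion_nth_0 0 algebra_simps flip: H_def)
  have G1: "fps_nth G 1 = (1 - g 0 * cnj (g 0)) * h 0"
    using arg_cong[OF gh, of "\<lambda>F. fps_nth F 1"]
    by (simp add: fps_mult_nth fps_expansion_nth_0 0 algebra_simps flip: G_def H_def)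
  have "fps_nth G 2 + cnj (g 0) * (fps_nth G 1 * h 0 + g 0 * fps_nth H 1) = fps_nth H 1"
    using arg_cong[OF gh, of "\<lambda>F. fps_nth F 2"]
    by (simp add: fps_mult_nth 0 algebra_simps numeral_2_eq_2 flip: G_def H_def)
  then have G2: "fps_nth G 2 =
      (1 - g 0 * cnj (g 0)) * ((1 - h 0 * cnj (h 0)) * k 0 - cnj (g 0) * h 0 ^ 2)"
    unfolding G1 H1 by (simp add: algebra_simps power2_eq_square)
  show thesis
    \<comment> \<open>Squared norms become \<open>z * cnj z\<close>, the form in which
      \<open>G1\<close> and \<open>G2\<close> are stated.\<close>
    by (rule that[of "g 0" "h 0" "k 0", unfolded complex_norm_square])
      (use g(2) h(2) k(2) G1 G2 in \<open>simp_all add: WG 0\<close>)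
qed

section \<open>Sharp inequalities for the Schur parameters\<close>

text \<open>Multiplied by \<open>1 - X\<close>, this expression is the difference of the squared
  sides of \<open>Schur_cubic_bound\<close>, where \<open>X\<close> and \<open>Y\<close> stand for
  the squared norms of \<open>a\<close> and \<open>b\<close>, and \<open>p\<close> for the real part
  of the rotated \<open>b\<close>.\<close>

lemma Schur_polynomial_nonneg:
  fixes X Y p :: real
  assumes X: "0 \<le> X" "X \<le> 1" and Y: "0 \<le> Y" "Y \<le> 1"
  shows "196/81 * (1 + X + X^2) - 28/9 * (1 - Y) + (1 - X) * (1 - Y)^2
      + 28/9 * X^2 * (2 * p^2 - Y + 3 * p) - X * (1 - X) * Y * (Y + 9 + 6 * p) \<ge> 0"
    (is "?H \<ge> 0")
proof -
  define s where "s = 1 - X"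
  \<comment> \<open>\<open>?H\<close> is a convex quadratic in \<open>p\<close>; completing the square leaves a polynomial that is
    concave in \<open>Y\<close>, whose values at \<open>Y = 0\<close> and \<open>Y = 1\<close> are \<open>?K0\<close> and \<open>?K1\<close>.\<close>
  let ?K0 = "25/81 + 115/81 * X - 175/162 * X^2"
  let ?K1 = "196/81 * (1 + X + X^2) - 28/9 * X^2 - 10 * X * s - 81/56 * (14/9 * X - s)^2"
  have "?H = 56/9 * (X * p + 27/56 * (14/9 * X - s * Y))^2
      + (1 - Y) * ?K0 + Y * ?K1 + 25/56 * s^2 * (Y * (1 - Y))"
    unfolding s_def by (simp add: field_simps power2_eq_square)
  moreover have "?K0 \<ge> 0"
    using mult_right_mono[OF X(2) X(1)] X by (simp add: power2_eq_square)
  moreover have "?K1 \<ge> 0"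
  proof -
    have "X^2 \<le> X"
      using mult_right_mono[OF X(2) X(1)] by (simp add: power2_eq_square)
    \<comment> \<open>The constant term is about 0.97, while the coefficients of \<open>X\<close>
      and \<open>X^2\<close> are about -0.19 and -0.14, so \<open>X^2 \<le> X \<le> 1\<close>
      suffices.\<close>
    moreover have "?K1 = (196/81 - 81/56) + (196/81 - 10 + 81/28 * (23/9)) * X
        - (28/9 - 196/81 - 10 + 81/56 * (23/9)^2) * X^2"
      unfolding s_def by (simp add: field_simps power2_eq_square)
    ultimately show ?thesis
      using X by (simp add: power2_eq_square)
  qed
  ultimately show ?thesis
    using X Y by simp
qed

text \<open>The right side is what the bound 14/9 leaves once the term with \<open>d\<close> takes
  its largest modulus. Replacing \<open>a\<close>, \<open>b\<close> by \<open>u * a\<close>,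
  \<open>u^2 * b\<close> with \<open>u\<close> unimodular multiplies the expression on the left by
  \<open>u^3\<close>, so \<open>a\<close> can be rotated to a nonnegative real.\<close>

lemma Schur_cubic_bound:
  fixes a b :: complex
  assumes a: "norm a \<le> 1" and b: "norm b \<le> 1"
  defines "s \<equiv> 1 - norm a ^ 2"
  shows "norm (14/9 * a ^ 3 - of_real s * (3 * a * b + cnj a * b ^ 2))
           \<le> 14/9 - s * (1 - norm b ^ 2)"
proof -
  \<comment> \<open>Unlike \<open>a / norm a\<close>, this \<open>u\<close> is unimodular even for
    \<open>a = 0\<close>.\<close>
  define x u where "x = norm a" and "u = cis (Arg a)"
  define c where "c = b * cnj u ^ 2"
  define p q where "p = Re c" and "q = Im c"
  have uu: "u * cnj u = 1" and nu: "norm u = 1"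
    by (simp_all add: u_def cis_cnj cis_mult)
  have au: "a = of_real x * u"
    using rcis_cmod_Arg[of a] by (simp add: x_def u_def rcis_def)
  have cn: "norm c = norm b"
    by (simp add: c_def norm_mult norm_power nu)
  have "u ^ 2 * c = b * (u * cnj u) ^ 2"
    by (simp add: c_def power_mult_distrib)
  then have bu: "b = u ^ 2 * c"
    by (simp add: uu)
  have x: "0 \<le> x" "x \<le> 1" "x^2 \<le> 1"
    using a by (simp_all add: x_def power_le_one)
  have Y: "norm b ^ 2 = p^2 + q^2"
    unfolding cn[symmetric] p_def q_def by (simp add: cmod_power2)
  have Y1: "p^2 + q^2 \<le> 1"
    using b by (simp flip: Y add: power_le_one)
  have s: "s = 1 - x^2"
    by (simp add: s_def x_def)
  have "14/9 * a ^ 3 - of_real s * (3 * a * b + cnj a * b ^ 2) =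
      of_real x * u ^ 3 * (of_real (14/9 * x^2) - of_real s * (3 * c + c^2))"
  proof -
    have "cnj a * b^2 = of_real x * (u * cnj u) * u^3 * c^2"
      by (simp add: au bu power2_eq_square power3_eq_cube)
    then show ?thesis
      by (simp add: uu) (simp add: au bu power2_eq_square power3_eq_cube algebra_simps)
  qed
  then have "norm (14/9 * a ^ 3 - of_real s * (3 * a * b + cnj a * b ^ 2)) ^ 2 =
      x^2 * norm (of_real (14/9 * x^2) - of_real s * (3 * c + c^2)) ^ 2"
    by (simp add: norm_mult norm_power nu power_mult_distrib)
  also have "\<dots> = x^2 * ((14/9 * x^2 - s * (3 * p + (p^2 - q^2)))^2 + (s * (3 * q + 2 * p * q))^2)"
    unfolding cmod_power2 p_def q_def by (simp add: power2_eq_square mult_ac)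
  also have "\<dots> \<le> (14/9 - s * (1 - norm b ^ 2)) ^ 2"
  proof -
    define X where "X = x^2"
    have "0 \<le> (1 - X) * (196/81 * (1 + X + X^2) - 28/9 * (1 - (p^2 + q^2))
        + (1 - X) * (1 - (p^2 + q^2))^2 + 28/9 * X^2 * (2 * p^2 - (p^2 + q^2) + 3 * p)
        - X * (1 - X) * (p^2 + q^2) * (p^2 + q^2 + 9 + 6 * p))"
      by (intro mult_nonneg_nonneg Schur_polynomial_nonneg) (use x Y1 in \<open>auto simp: X_def\<close>)
    also have "\<dots> = (14/9 - (1 - X) * (1 - (p^2 + q^2))) ^ 2
        - X * ((14/9 * X - (1 - X) * (3 * p + (p^2 - q^2)))^2 + ((1 - X) * (3 * q + 2 * p * q))^2)"
      by (simp add: field_simps power2_eq_square)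
    finally show ?thesis
      by (simp add: X_def s Y)
  qed
  finally show ?thesis
  proof (rule power2_le_imp_le)
    have "s * (1 - norm b ^ 2) \<le> 1 * 1"
      using x Y1 by (intro mult_mono) (auto simp: s Y)
    then show "0 \<le> 14/9 - s * (1 - norm b ^ 2)"
      by simp
  qed
qed

lemma norm_one_minus_norm_square:
  fixes z :: complex
  assumes "norm z \<le> 1"
  shows "norm (1 - complex_of_real (norm z ^ 2)) = 1 - norm z ^ 2"
proof -
  have "1 - complex_of_real (norm z ^ 2) = of_real (1 - norm z ^ 2)"
    by simp
  also have "norm \<dots> = 1 - norm z ^ 2"
    unfolding norm_of_real using assms by (simp add: power_le_one)
  finally show ?thesis .
qed

lemma Schwarz_coeff_bound_2:
  fixes a b :: complex
  assumes a: "norm a \<le> 1" and b: "norm b \<le> 1"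
  shows "norm (4 * ((1 - of_real (norm a ^ 2)) * b) - 10/3 * a ^ 2) \<le> 4"
proof -
  have "norm a ^ 2 \<le> 1"
    using a by (simp add: power_le_one)
  then have "(1 - norm a ^ 2) * norm b \<le> (1 - norm a ^ 2) * 1"
    using b by (intro mult_left_mono) auto
  then have "norm (4 * ((1 - of_real (norm a ^ 2)) * b)) \<le> 4 * (1 - norm a ^ 2)"
    unfolding norm_mult norm_one_minus_norm_square[OF a] by simp
  \<comment> \<open>Enlarging 10/3 to 4 makes the terms in \<open>norm a ^ 2\<close> cancel.\<close>
  moreover have "norm (10/3 * a ^ 2) \<le> 4 * norm a ^ 2"
    by (simp add: norm_mult norm_power)
  ultimately have "norm (4 * ((1 - of_real (norm a ^ 2)) * b)) + norm (10/3 * a ^ 2)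
      \<le> 4 * (1 - norm a ^ 2) + 4 * norm a ^ 2"
    by (rule add_mono)
  then show ?thesis
    by (intro order_trans[OF norm_triangle_ineq4]) simp
qed

lemma Schwarz_coeff_bound_3:
  fixes a b d :: complex
  assumes a: "norm a \<le> 1" and b: "norm b \<le> 1" and d: "norm d \<le> 1"
  defines "s \<equiv> 1 - of_real (norm a ^ 2)"
  shows "norm (s * ((1 - of_real (norm b ^ 2)) * d - cnj a * b ^ 2) - 3 * a * (s * b)
           + 14/9 * a ^ 3) \<le> 14/9"
proof -
  have le: "norm a ^ 2 \<le> 1" "norm b ^ 2 \<le> 1"
    using a b by (simp_all add: power_le_one)
  have sr: "s = of_real (1 - norm a ^ 2)"
    by (simp add: s_def)
  have "norm (s * (1 - of_real (norm b ^ 2)) * d) =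
      (1 - norm a ^ 2) * (1 - norm b ^ 2) * norm d"
    unfolding s_def norm_mult norm_one_minus_norm_square[OF a] norm_one_minus_norm_square[OF b] ..
  also have "\<dots> \<le> (1 - norm a ^ 2) * (1 - norm b ^ 2) * 1"
    using le d by (intro mult_left_mono) auto
  finally have "norm (s * (1 - of_real (norm b ^ 2)) * d) \<le> (1 - norm a ^ 2) * (1 - norm b ^ 2)"
    by simp
  with Schur_cubic_bound[OF a b]
  have "norm (s * (1 - of_real (norm b ^ 2)) * d
      + (14/9 * a ^ 3 - s * (3 * a * b + cnj a * b ^ 2))) \<le> 14/9"
    unfolding sr[symmetric] by (intro norm_triangle_le) simp
  then show ?thesis
    by (simp add: algebra_simps)
qed

section \<open>Coefficient formulas for the Schippers derivatives at the origin\<close>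

lemma schippers_at_0:
  assumes F: "f has_fps_expansion F" and F0: "fps_nth F 0 = 0" and F1: "fps_nth F 1 = 1"
  shows "\<sigma> 3 f 0 = 6 * (fps_nth F 3 - fps_nth F 2 ^ 2)"
    and "\<sigma> 4 f 0 = 24 * (fps_nth F 4 - 3 * fps_nth F 2 * fps_nth F 3 + 2 * fps_nth F 2 ^ 3)"
proof -
  define P where "P = fps_deriv (fps_deriv F) / fps_deriv F"
  define S where "S = fps_deriv P - fps_const (1/2) * P ^ 2"
  note F' = has_fps_expansion_deriv[OF F]
  have nz: "fps_nth (fps_deriv F) 0 \<noteq> 0"
    using F1 by simp
  have P: "pre_schwarzian f has_fps_expansion P"
    unfolding pre_schwarzian_def P_def
    by (rule has_fps_expansion_divide'[OF has_fps_expansion_deriv[OF F'] F' nz])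
  have S: "schwarzian f has_fps_expansion S"
    unfolding schwarzian_def S_def
    by (intro fps_expansion_intros P)
  have s3: "\<sigma> 3 f = schwarzian f"
    by (simp add: numeral_3_eq_3)
  \<comment> \<open>The recursion is used at \<open>n = 3\<close>, hence the factor 2.\<close>
  have s4: "\<sigma> 4 f = (\<lambda>z. deriv (schwarzian f) z - 2 * schwarzian f z * pre_schwarzian f z)"
    using s3 by (simp add: eval_nat_numeral)
  have T: "\<sigma> 4 f has_fps_expansion fps_deriv S - 2 * S * P"
    unfolding s4 by (intro fps_expansion_intros P S)
  \<comment> \<open>In product form, comparing coefficients yields those of \<open>P\<close> one
    after the other, as \<open>fps_deriv F\<close> has constant term 1.\<close>
  have PF: "P * fps_deriv F = fps_deriv (fps_deriv F)"
    unfolding P_def using nz by (simp add: fps_divide_unit mult.assoc inverse_mult_eq_1)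
  have P0: "fps_nth P 0 = 2 * fps_nth F 2"
    using arg_cong[OF PF, of "\<lambda>G. fps_nth G 0"] F1 by (simp add: numeral_2_eq_2)
  have P1: "fps_nth P 1 = 6 * fps_nth F 3 - 4 * fps_nth F 2 ^ 2"
    using arg_cong[OF PF, of "\<lambda>G. fps_nth G 1"] F1 P0
    by (simp add: fps_mult_nth eval_nat_numeral algebra_simps)
  have "fps_nth P 2 =
      12 * fps_nth F 4 - 2 * fps_nth F 2 * fps_nth P 1 - 3 * fps_nth F 3 * fps_nth P 0"
    using arg_cong[OF PF, of "\<lambda>G. fps_nth G 2"] F1
    by (simp add: fps_mult_nth eval_nat_numeral algebra_simps)
  then have P2: "fps_nth P 2 =
      12 * fps_nth F 4 - 18 * fps_nth F 2 * fps_nth F 3 + 8 * fps_nth F 2 ^ 3"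
    unfolding P0 P1 by (simp add: power2_eq_square power3_eq_cube algebra_simps)
  have S0: "fps_nth S 0 = 6 * (fps_nth F 3 - fps_nth F 2 ^ 2)"
    using P0 P1 by (simp add: S_def power2_eq_square algebra_simps)
  show "\<sigma> 3 f 0 = 6 * (fps_nth F 3 - fps_nth F 2 ^ 2)"
    using has_fps_expansion_imp_0_eq_fps_nth_0[OF S] S0 s3 by simp
  have S1: "fps_nth S 1 = 2 * fps_nth P 2 - fps_nth P 0 * fps_nth P 1"
    by (simp add: S_def power2_eq_square fps_mult_nth numeral_2_eq_2 algebra_simps)
  show "\<sigma> 4 f 0 = 24 * (fps_nth F 4 - 3 * fps_nth F 2 * fps_nth F 3 + 2 * fps_nth F 2 ^ 3)"
  proof -
    have "\<sigma> 4 f 0 = fps_nth S 1 - 2 * fps_nth S 0 * fps_nth P 0"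
      using has_fps_expansion_imp_0_eq_fps_nth_0[OF T] by simp
    then show ?thesis
      unfolding S0 S1 P0 P1 P2 by (simp add: power2_eq_square power3_eq_cube algebra_simps)
  qed
qed

text \<open>The differential equation without division makes sense at the origin and determines the
  coefficients of \<open>f\<close> recursively. The formulas serve both the bounds and the extremal
  functions.\<close>

lemma schippers_of_Schwarz_coeffs:
  assumes f: "f \<in> \<A>" and W: "w has_fps_expansion W" and w0: "w 0 = 0"
    and eq: "\<And>z. norm z < 1 \<Longrightarrow> z * deriv f z = f z * (1 + 4/3 * w z + 2/3 * w z ^ 2)"
  shows "\<sigma> 3 f 0 = 4 * fps_nth W 2 - 10/3 * fps_nth W 1 ^ 2"
    and "\<sigma> 4 f 0 = 32/3 * (fps_nth W 3 - 3 * fps_nth W 1 * fps_nth W 2 + 14/9 * fps_nth W 1 ^ 3)"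
proof -
  define F where "F = fps_expansion f 0"
  have holf: "f holomorphic_on \<bbbD>" and f0: "f 0 = 0" and f1: "deriv f 0 = 1"
    using f by (auto simp: class_A_def)
  have F: "f has_fps_expansion F"
    unfolding F_def by (rule has_fps_expansion_unit_disk[OF holf])
  have F0: "fps_nth F 0 = 0" and F1: "fps_nth F 1 = 1"
    using f0 f1 by (simp_all add: F_def fps_expansion_def)
  have W0: "fps_nth W 0 = 0"
    using has_fps_expansion_imp_0_eq_fps_nth_0[OF W] w0 by simp
  have FW: "fps_X * fps_deriv F = F * (1 + fps_const (4/3) * W + fps_const (2/3) * W ^ 2)"
  proof (rule fps_eq_if_eq_on_unit_disk)
    show "(\<lambda>z. z * deriv f z) has_fps_expansion fps_X * fps_deriv F"
      by (intro fps_expansion_intros F)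
    show "(\<lambda>z. f z * (1 + 4/3 * w z + 2/3 * w z ^ 2)) has_fps_expansion
        F * (1 + fps_const (4/3) * W + fps_const (2/3) * W ^ 2)"
      by (intro fps_expansion_intros F W)
  qed (rule eq)
  let ?c = "fps_nth W"
  have F2: "fps_nth F 2 = 4/3 * ?c 1"
    using arg_cong[OF FW, of "\<lambda>G. fps_nth G 2"] F0 F1 W0
    by (simp add: fps_mult_nth eval_nat_numeral algebra_simps)
  \<comment> \<open>The n-th coefficient of \<open>F\<close> occurs n times on the left of
    \<open>FW\<close> and once on the right, which leaves the factor n - 1.\<close>
  have e3: "2 * fps_nth F 3 = 4/3 * ?c 2 + 2/3 * ?c 1 ^ 2 + 4/3 * ?c 1 * fps_nth F 2"
    using arg_cong[OF FW, of "\<lambda>G. fps_nth G 3"] F0 F1 W0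
    by (simp add: fps_mult_nth eval_nat_numeral algebra_simps)
  have "2 * fps_nth F 3 = 2 * (2/3 * ?c 2 + 11/9 * ?c 1 ^ 2)"
    unfolding e3 F2 by (simp add: field_simps power2_eq_square)
  then have F3: "fps_nth F 3 = 2/3 * ?c 2 + 11/9 * ?c 1 ^ 2"
    by (subst (asm) mult_left_cancel) simp_all
  have e4: "3 * fps_nth F 4 = 4/3 * ?c 3 + 4/3 * ?c 1 * ?c 2
      + (4/3 * ?c 2 + 2/3 * ?c 1 ^ 2) * fps_nth F 2 + 4/3 * ?c 1 * fps_nth F 3"
    using arg_cong[OF FW, of "\<lambda>G. fps_nth G 4"] F0 F1 W0
    by (simp add: fps_mult_nth eval_nat_numeral algebra_simps)
  have "3 * fps_nth F 4 = 3 * (4/9 * ?c 3 + 4/3 * ?c 1 * ?c 2 + 68/81 * ?c 1 ^ 3)"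
    unfolding e4 F2 F3 by (simp add: field_simps power2_eq_square power3_eq_cube)
  then have F4: "fps_nth F 4 = 4/9 * ?c 3 + 4/3 * ?c 1 * ?c 2 + 68/81 * ?c 1 ^ 3"
    by (subst (asm) mult_left_cancel) simp_all
  note \<sigma> = schippers_at_0[OF F F0 F1]
  show "\<sigma> 3 f 0 = 4 * ?c 2 - 10/3 * ?c 1 ^ 2"
    unfolding \<sigma> F2 F3 by (simp add: power2_eq_square algebra_simps)
  show "\<sigma> 4 f 0 = 32/3 * (?c 3 - 3 * ?c 1 * ?c 2 + 14/9 * ?c 1 ^ 3)"
    unfolding \<sigma> F2 F3 F4 by (simp add: power2_eq_square power3_eq_cube algebra_simps)
qed

section \<open>The bounds and their sharpness\<close>

lemma S_car_bounds:
  assumes f: "f \<in> S_car"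
  shows "norm (\<sigma> 3 f 0) \<le> 4" and "norm (\<sigma> 4 f 0) \<le> 448/27"
proof -
  have fA: "f \<in> \<A>" and nz: "\<And>z. norm z < 1 \<Longrightarrow> z \<noteq> 0 \<Longrightarrow> f z \<noteq> 0"
    using f by (auto simp: S_car_def)
  obtain w where w: "w holomorphic_on \<bbbD>" "w 0 = 0" "\<And>z. norm z < 1 \<Longrightarrow> norm (w z) < 1"
    and sub: "\<And>z. norm z < 1 \<Longrightarrow> starlike_quotient f z = 1 + 4/3 * w z + 2/3 * w z ^ 2"
    using f by (auto simp: S_car_def subordinate_def)
  \<comment> \<open>At the origin both sides vanish because \<open>f 0 = 0\<close>; elsewhere
    \<open>f z\<close> is nonzero and the quotient can be cleared.\<close>
  have eq: "z * deriv f z = f z * (1 + 4/3 * w z + 2/3 * w z ^ 2)" if "norm z < 1" for z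
    using sub[OF that] nz[OF that] fA
    by (cases "z = 0") (auto simp: starlike_quotient_def class_A_def field_simps)
  define W where "W = fps_expansion w 0"
  have W: "w has_fps_expansion W"
    unfolding W_def by (rule has_fps_expansion_unit_disk[OF w(1)])
  have \<sigma>: "\<sigma> 3 f 0 = 4 * fps_nth W 2 - 10/3 * fps_nth W 1 ^ 2"
    "\<sigma> 4 f 0 = 32/3 * (fps_nth W 3 - 3 * fps_nth W 1 * fps_nth W 2 + 14/9 * fps_nth W 1 ^ 3)"
    by (rule schippers_of_Schwarz_coeffs[OF fA W w(2) eq]; assumption)+
  obtain a b d where n: "norm a \<le> 1" "norm b \<le> 1" "norm d \<le> 1" and c: "fps_nth W 1 = a"
    "fps_nth W 2 = (1 - of_real (norm a ^ 2)) * b"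
    "fps_nth W 3 = (1 - of_real (norm a ^ 2)) * ((1 - of_real (norm b ^ 2)) * d - cnj a * b ^ 2)"
    using Schwarz_coeffs[OF w W] by blast
  show "norm (\<sigma> 3 f 0) \<le> 4"
    unfolding \<sigma>(1) c by (rule Schwarz_coeff_bound_2[OF n(1,2)])
  show "norm (\<sigma> 4 f 0) \<le> 448/27"
    unfolding \<sigma>(2) c norm_mult[of "32/3"] using Schwarz_coeff_bound_3[OF n] by simp
qed

text \<open>This \<open>f\<close> belongs to the Schwarz function \<open>z ^ k\<close>: the
  logarithm of \<open>f z / z\<close> is the integral from 0 to \<open>z\<close> of
  \<open>4/3 * t ^ (k - 1) + 2/3 * t ^ (2 * k - 1)\<close>.\<close>

lemma S_car_extremal:
  fixes k :: nat
  assumes k: "k \<ge> 1"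
  defines "f \<equiv> \<lambda>z. z * exp ((4/3 * z ^ k + 1/3 * z ^ (2 * k)) / of_nat k)"
  shows "f \<in> S_car"
    and "\<sigma> 3 f 0 = 4 * fps_nth (fps_X ^ k) 2 - 10/3 * fps_nth (fps_X ^ k) 1 ^ 2"
    and "\<sigma> 4 f 0 = 32/3 * (fps_nth (fps_X ^ k) 3
           - 3 * fps_nth (fps_X ^ k) 1 * fps_nth (fps_X ^ k) 2 + 14/9 * fps_nth (fps_X ^ k) 1 ^ 3)"
proof -
  define e where "e z = exp ((4/3 * z ^ k + 1/3 * z ^ (2 * k)) / of_nat k)" for z :: complex
  have fe: "f z = z * e z" for z
    by (simp add: f_def e_def)
  have kz: "of_nat k \<noteq> (0::complex)"
    using k by simp
  have d: "deriv f z = e z * (1 + 4/3 * z ^ k + 2/3 * (z ^ k) ^ 2)" for z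
  proof -
    \<comment> \<open>For \<open>m = 0\<close> the exponent is truncated to 0, but the factor
      \<open>of_nat m\<close> makes both sides vanish.\<close>
    have pw: "z * (of_nat m * z ^ (m - 1)) = of_nat m * z ^ m" for m :: nat
      by (cases m) auto
    have "(f has_field_derivative e z + z * (e z * ((4/3 * (of_nat k * z ^ (k - 1))
        + 1/3 * (of_nat (2 * k) * z ^ (2 * k - 1))) / of_nat k))) (at z)"
      unfolding f_def e_def using k by (auto intro!: derivative_eq_intros)
    then have dz: "deriv f z = e z + e z * ((4/3 * (z * (of_nat k * z ^ (k - 1)))
        + 1/3 * (z * (of_nat (2 * k) * z ^ (2 * k - 1)))) / of_nat k)"
      by (simp add: DERIV_imp_deriv algebra_simps add_divide_distrib)
    have kk: "(4/3 * (of_nat k * z ^ k) + 1/3 * (of_nat (2 * k) * z ^ (2 * k))) / of_nat k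
        = 4/3 * z ^ k + 2/3 * (z ^ k) ^ 2"
      using kz by (simp add: add_divide_distrib mult.commute[of 2 k] power_mult)
    show ?thesis
      unfolding dz pw kk by (simp add: algebra_simps)
  qed
  have fA: "f \<in> \<A>"
    using k unfolding class_A_def d mem_Collect_eq
    by (auto simp: d e_def f_def power_0_left intro!: holomorphic_intros)
  have eq: "z * deriv f z = f z * (1 + 4/3 * z ^ k + 2/3 * (z ^ k) ^ 2)" for z
    by (simp add: d fe)
  have "starlike_quotient f = (\<lambda>z. 1 + 4/3 * z ^ k + 2/3 * (z ^ k) ^ 2)"
    using k by (auto simp: fun_eq_iff starlike_quotient_def d fe e_def power_0_left)
  then have "starlike_quotient f \<prec> (\<lambda>z. 1 + 4/3 * z + 2/3 * z^2)"
    unfolding subordinate_def using k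
    by (auto intro!: holomorphic_intros exI[of _ "\<lambda>z. z ^ k"]
        simp: norm_power power_less_one_iff power_0_left)
  then show "f \<in> S_car"
    using fA by (auto simp: S_car_def fe e_def)
  note * = schippers_of_Schwarz_coeffs[OF fA has_fps_expansion_fps_X_power _ eq]
  show "\<sigma> 3 f 0 = 4 * fps_nth (fps_X ^ k) 2 - 10/3 * fps_nth (fps_X ^ k) 1 ^ 2"
    and "\<sigma> 4 f 0 = 32/3 * (fps_nth (fps_X ^ k) 3
           - 3 * fps_nth (fps_X ^ k) 1 * fps_nth (fps_X ^ k) 2 + 14/9 * fps_nth (fps_X ^ k) 1 ^ 3)"
    using * k by (simp_all add: power_0_left)
qed

theorem theorem3p3:
  "(\<forall>f \<in> S_car. norm (\<sigma> 3 f 0) \<le> 4 \<and> norm (\<sigma> 4 f 0) \<le> 448/27) \<and>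
   (\<exists>f \<in> S_car. norm (\<sigma> 3 f 0) = 4) \<and>
   (\<exists>f \<in> S_car. norm (\<sigma> 4 f 0) = 448/27)"
proof (intro conjI ballI)
  \<comment> \<open>With \<open>k = 2\<close> only the second Schwarz coefficient is nonzero; with
    \<open>k = 1\<close>, used below, only the first, and 32/3 times 14/9 is 448/27.\<close>
  show "\<exists>f \<in> S_car. norm (\<sigma> 3 f 0) = 4"
    by (rule bexI[OF _ S_car_extremal(1)[of 2, OF one_le_numeral]])
      (unfold S_car_extremal(2)[of 2, OF one_le_numeral], simp)
  show "\<exists>f \<in> S_car. norm (\<sigma> 4 f 0) = 448/27"
    by (rule bexI[OF _ S_car_extremal(1)[OF order_refl]])
      (unfold S_car_extremal(3)[OF order_refl], simp)
qed (rule S_car_bounds, assumption)+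

end
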